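(* If $G$ is a graph of order $n\ge 2$, then $\mu_1(G)+\mu_2(G)\le \frac{2}{\sqrt3}\,n$.
   Context: Graphs are finite, simple and undirected; the order of a graph is its number of vertices. For a graph $G$ of order $n$, $\mu_1(G)\ge\cdots\ge\mu_n(G)$ are the eigenvalues of its adjacency matrix, listed with multiplicity. *)

theory Defs
  imports
    Complex_Main
    "HOL-Computational_Algebra.Fundamental_Theorem_Algebra"
    "Jordan_Normal_Form.Char_Poly"
    "Graph_Theory.Pair_Digraph"
begin

text \<open>
  Finite simple undirected graphs are the structures satisfying the predicate \<open>pair_graph\<close>:
  a finite vertex set \<open>pverts G\<close> together with a symmetric irreflexive relation \<open>parcs G\<close> on it,
  so that every undirected edge is represented by both of its orientations.
\<close>

definition graph_order :: "'a pair_pre_digraph \<Rightarrow> nat" where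
  "graph_order G = card (pverts G)"

definition adjacency_mat :: "'a pair_pre_digraph \<Rightarrow> 'a list \<Rightarrow> real mat" where
  "adjacency_mat G vs =
     mat (length vs) (length vs) (\<lambda>(i, j). if (vs ! i, vs ! j) \<in> parcs G then 1 else 0)"

text \<open>
  The choice of the enumeration of the vertices does not affect the characteristic polynomial,
  see \<open>char_poly_adjacency_mat_cong\<close> below.
\<close>

definition vertex_list :: "'a pair_pre_digraph \<Rightarrow> 'a list" where
  "vertex_list G = (SOME vs. distinct vs \<and> set vs = pverts G)"

definition adjacency_eigenvalues :: "'a pair_pre_digraph \<Rightarrow> real list" where
  "adjacency_eigenvalues G =
     rev (sorted_list_of_multiset (proots (char_poly (adjacency_mat G (vertex_list G)))))"

text \<open>The index starts at 1; \<open>\<mu> G k\<close> is meaningful for \<open>1 \<le> k \<le> graph_order G\<close> only.\<close>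

definition \<mu> :: "'a pair_pre_digraph \<Rightarrow> nat \<Rightarrow> real" where
  "\<mu> G k = adjacency_eigenvalues G ! (k - 1)"

lemma adjacency_mat_carrier [simp]:
  "adjacency_mat G vs \<in> carrier_mat (length vs) (length vs)"
  by (simp add: adjacency_mat_def)

lemma char_poly_adjacency_mat_cong:
  assumes vs: "distinct vs" and ws: "distinct ws" and eq: "set vs = set ws"
  shows "char_poly (adjacency_mat G vs) = char_poly (adjacency_mat G ws)"
proof -
  define n where "n = length vs"
  have nvs: "length vs = n" and nws: "length ws = n"
    using vs ws eq by (simp_all add: n_def flip: distinct_card)
  have ex: "\<exists>k<n. ws ! k = x" if "x \<in> set vs" for x
    using that nws unfolding eq in_set_conv_nth by blast
  have ex': "\<exists>k<n. vs ! k = x" if "x \<in> set ws" for x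
    using that nvs unfolding eq[symmetric] in_set_conv_nth by blast
  have "\<forall>i\<in>{..<n}. \<exists>k<n. ws ! k = vs ! i"
    using ex nvs by (metis lessThan_iff nth_mem)
  then obtain f where f: "\<And>i. i < n \<Longrightarrow> f i < n" "\<And>i. i < n \<Longrightarrow> ws ! f i = vs ! i"
    by (metis lessThan_iff)
  have "\<forall>i\<in>{..<n}. \<exists>k<n. vs ! k = ws ! i"
    using ex' nws by (metis lessThan_iff nth_mem)
  then obtain g where g: "\<And>i. i < n \<Longrightarrow> g i < n" "\<And>i. i < n \<Longrightarrow> vs ! g i = ws ! i"
    by (metis lessThan_iff)
  have fg: "vs ! i = ws ! j \<longleftrightarrow> j = f i" if "i < n" "j < n" for i j
    using that f ws nws by (metis nth_eq_iff_index_eq)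
  have gf: "vs ! i = ws ! j \<longleftrightarrow> i = g j" if "i < n" "j < n" for i j
    using that g vs nvs by (metis nth_eq_iff_index_eq)
  have gf': "ws ! j = vs ! i \<longleftrightarrow> i = g j" if "i < n" "j < n" for i j
    using gf[OF that] by auto
  define P :: "real mat" where "P = mat n n (\<lambda>(i, j). if vs ! i = ws ! j then 1 else 0)"
  define Q :: "real mat" where "Q = mat n n (\<lambda>(i, j). if ws ! i = vs ! j then 1 else 0)"
  have P: "P \<in> carrier_mat n n" and Q: "Q \<in> carrier_mat n n"
    by (simp_all add: P_def Q_def)
  have A: "adjacency_mat G vs \<in> carrier_mat n n" and B: "adjacency_mat G ws \<in> carrier_mat n n"
    using adjacency_mat_carrier[of G vs] adjacency_mat_carrier[of G ws] nvs nws by simp_all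
  have pick: "(\<Sum>k = 0..<n. (if vs ! i = ws ! k then 1 else 0) * h k) = h (f i)"
    if "i < n" for i and h :: "nat \<Rightarrow> real"
  proof -
    have "(\<Sum>k = 0..<n. (if vs ! i = ws ! k then 1 else 0) * h k)
        = (\<Sum>k = 0..<n. if k = f i then h k else 0)"
      using fg that by (intro sum.cong) auto
    also have "\<dots> = h (f i)" using f(1)[OF that] by simp
    finally show ?thesis .
  qed
  have pick': "(\<Sum>k = 0..<n. (if ws ! i = vs ! k then 1 else 0) * h k) = h (g i)"
    if "i < n" for i and h :: "nat \<Rightarrow> real"
  proof -
    have "(\<Sum>k = 0..<n. (if ws ! i = vs ! k then 1 else 0) * h k)
        = (\<Sum>k = 0..<n. if k = g i then h k else 0)"
      using gf' that by (intro sum.cong) auto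
    also have "\<dots> = h (g i)" using g(1)[OF that] by simp
    finally show ?thesis .
  qed
  have PQ: "P * Q = 1\<^sub>m n"
    by (rule eq_matI)
      (use f vs nvs in \<open>auto simp: P_def Q_def scalar_prod_def pick nth_eq_iff_index_eq\<close>)
  have QP: "Q * P = 1\<^sub>m n"
    by (rule eq_matI)
      (use g ws nws in \<open>auto simp: P_def Q_def scalar_prod_def pick' nth_eq_iff_index_eq\<close>)
  have AP: "P * adjacency_mat G ws = adjacency_mat G vs * P"
  proof (rule eq_matI)
    fix i j assume "i < dim_row (adjacency_mat G vs * P)" "j < dim_col (adjacency_mat G vs * P)"
    then have ij: "i < n" "j < n" using A P by auto
    have "(P * adjacency_mat G ws) $$ (i, j) = (if (vs ! i, ws ! j) \<in> parcs G then 1 else 0)"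
      using ij f by (simp add: P_def adjacency_mat_def nws scalar_prod_def pick)
    moreover have "(adjacency_mat G vs * P) $$ (i, j)
        = (\<Sum>k = 0..<n. if k = g j then (if (vs ! i, vs ! k) \<in> parcs G then 1 else 0) else 0)"
      (is "_ = ?rhs")
    proof -
      have "(adjacency_mat G vs * P) $$ (i, j)
          = (\<Sum>k = 0..<n. (if (vs ! i, vs ! k) \<in> parcs G then 1 else 0) *
                          (if vs ! k = ws ! j then 1 else 0))"
        using ij by (simp add: P_def adjacency_mat_def nvs scalar_prod_def)
      also have "\<dots> = ?rhs"
        using ij gf by (intro sum.cong) auto
      finally show ?thesis .
    qed
    ultimately show "(P * adjacency_mat G ws) $$ (i, j) = (adjacency_mat G vs * P) $$ (i, j)"
      using g ij by simp
  qed (use A B P in auto)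
  have "adjacency_mat G vs = adjacency_mat G vs * (P * Q)"
    using A by (simp add: PQ)
  also have "\<dots> = P * adjacency_mat G ws * Q"
    using A P Q by (simp add: AP)
  finally have "similar_mat_wit (adjacency_mat G vs) (adjacency_mat G ws) P Q"
    using A B P Q PQ QP by (auto simp: similar_mat_wit_def Let_def)
  then show ?thesis
    by (intro char_poly_similar) (auto simp: similar_mat_def)
qed

lemma size_proots_real_if_complex_roots_real:
  fixes p :: "real poly"
  assumes "p \<noteq> 0" and "\<And>z. poly (map_poly complex_of_real p) z = 0 \<Longrightarrow> z \<in> \<real>"
  shows "size (proots p) = degree p"
  using assms
proof (induction "degree p" arbitrary: p)
  case 0
  then show ?case by (metis degree_eq_zeroE proots_const size_empty)
next
  case (Suc n)
  have "\<not> constant (poly (map_poly complex_of_real p))"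
    using Suc.hyps(2) by (simp add: constant_degree degree_map_poly)
  then obtain z where z: "poly (map_poly complex_of_real p) z = 0"
    using fundamental_theorem_of_algebra by blast
  with Suc.prems obtain r where r: "z = of_real r" by (meson Reals_cases)
  have "poly p r = 0" using z by (simp add: r)
  then obtain q where q: "p = [:-r, 1:] * q" by (metis dvdE poly_eq_0_iff_dvd)
  have q0: "q \<noteq> 0" using q Suc.prems by auto
  have "degree p = Suc (degree q)" unfolding q by (subst degree_mult_eq) (use q0 in auto)
  moreover have "z \<in> \<real>" if "poly (map_poly complex_of_real q) z = 0" for z
  proof -
    have "map_poly complex_of_real p
        = map_poly complex_of_real [:-r, 1:] * map_poly complex_of_real q"
      unfolding q by (rule poly_eqI) (simp add: coeff_map_poly coeff_pCons split: nat.splits)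
    then show ?thesis using that Suc.prems(2) by simp
  qed
  ultimately have "size (proots q) = degree q" "degree p = Suc (degree q)"
    using Suc.hyps q0 by auto
  moreover have "proots p = proots [:-r, 1:] + proots q"
    unfolding q by (intro proots_mult) (use q0 in auto)
  ultimately show ?case by simp
qed

lemma complex_eigenvalue_real_symmetric:
  fixes A :: "real mat"
  assumes A: "A \<in> carrier_mat n n" and sym: "\<And>i j. i < n \<Longrightarrow> j < n \<Longrightarrow> A $$ (i, j) = A $$ (j, i)"
    and ev: "eigenvalue (map_mat complex_of_real A) z"
  shows "z \<in> \<real>"
proof -
  let ?B = "map_mat complex_of_real A"
  obtain v where v: "v \<in> carrier_vec n" "v \<noteq> 0\<^sub>v n" "?B *\<^sub>v v = z \<cdot>\<^sub>v v"
    using ev A by (auto simp: eigenvalue_def eigenvector_def)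
  have row: "(\<Sum>j<n. of_real (A $$ (i, j)) * v $ j) = z * v $ i" if "i < n" for i
  proof -
    have "(?B *\<^sub>v v) $ i = z * v $ i" using v that by simp
    moreover have "(?B *\<^sub>v v) $ i = (\<Sum>j<n. of_real (A $$ (i, j)) * v $ j)"
      using carrier_matD[OF A] carrier_vecD[OF v(1)] that
      by (simp add: scalar_prod_def lessThan_atLeast0)
    ultimately show ?thesis by simp
  qed
  define s where "s = (\<Sum>i<n. v $ i * cnj (v $ i))"
  define t where "t = (\<Sum>i<n. \<Sum>j<n. of_real (A $$ (i, j)) * v $ j * cnj (v $ i))"
  have t: "t = z * s"
    unfolding t_def s_def sum_distrib_left
    by (intro sum.cong refl) (simp add: row flip: sum_distrib_right mult.assoc)
  have "cnj t = (\<Sum>i<n. \<Sum>j<n. of_real (A $$ (i, j)) * v $ i * cnj (v $ j))"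
    by (simp add: t_def mult_ac)
  also have "\<dots> = (\<Sum>j<n. \<Sum>i<n. of_real (A $$ (i, j)) * v $ i * cnj (v $ j))"
    by (rule sum.swap)
  also have "\<dots> = t"
    unfolding t_def by (intro sum.cong refl) (simp add: sym)
  finally have "cnj t = t" .
  moreover have s: "s = of_real (\<Sum>i<n. (cmod (v $ i))\<^sup>2)"
    unfolding s_def by (simp only: complex_norm_square[symmetric] of_real_sum)
  ultimately have "cnj z * s = z * s" by (metis t complex_cnj_mult complex_cnj_complex_of_real)
  moreover have "s \<noteq> 0"
  proof
    assume "s = 0"
    then have "(\<Sum>i<n. (cmod (v $ i))\<^sup>2) = 0" using s by (metis of_real_eq_0_iff)
    then have "\<forall>i<n. v $ i = 0" by (simp add: sum_nonneg_eq_0_iff)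
    then have "v = 0\<^sub>v n" using v(1) by (intro eq_vecI) auto
    with v(2) show False by simp
  qed
  ultimately show ?thesis by (simp add: Reals_cnj_iff)
qed

lemma length_adjacency_eigenvalues:
  assumes "pair_graph G"
  shows "length (adjacency_eigenvalues G) = graph_order G"
proof -
  interpret pair_graph G by fact
  define vs where "vs = vertex_list G"
  have "distinct vs \<and> set vs = pverts G"
    unfolding vs_def vertex_list_def
    by (rule someI_ex) (metis pair_finite_verts finite_distinct_list)
  then have n: "length vs = graph_order G"
    by (metis distinct_card graph_order_def)
  let ?A = "adjacency_mat G vs"
  have A: "?A \<in> carrier_mat (length vs) (length vs)" by simp
  have sym: "?A $$ (i, j) = ?A $$ (j, i)" if "i < length vs" "j < length vs" for i j
    using that pair_sym_arcs by (auto simp: adjacency_mat_def symmetric_def dest: symD)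
  have deg: "degree (char_poly ?A) = length vs" "coeff (char_poly ?A) (length vs) = 1"
    using degree_monic_char_poly[OF A] by auto
  have "z \<in> \<real>" if "poly (map_poly complex_of_real (char_poly ?A)) z = 0" for z
  proof -
    have "eigenvalue (map_mat complex_of_real ?A) z"
      using that A by (subst eigenvalue_root_char_poly[of _ "length vs"])
        (auto simp: of_real_hom.char_poly_hom[OF A])
    then show ?thesis using complex_eigenvalue_real_symmetric[OF A sym] by blast
  qed
  then have "size (proots (char_poly ?A)) = length vs"
    using size_proots_real_if_complex_roots_real[of "char_poly ?A"] deg by fastforce
  then show ?thesis
    by (metis adjacency_eigenvalues_def length_rev mset_sorted_list_of_multiset n size_mset vs_def)
qed

end

theory Submission
  imports Defs "Jordan_Normal_Form.Schur_Decomposition"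
begin

text \<open>
  Let \<open>x \<ge> y \<ge> 0\<close> be the two largest eigenvalues of the adjacency matrix \<open>A\<close>, with orthonormal
  eigenvectors \<open>u\<close> and \<open>v\<close>, and let \<open>B = J - I - A\<close> belong to the complement. Then
  \<open>x\<^sup>2 + y\<^sup>2\<close> is at most the number of arcs of the graph. Some nonzero \<open>z\<close> in the span of \<open>u\<close>, \<open>v\<close>
  is orthogonal to the all-ones vector, whence \<open>z\<^sup>T B z \<le> -(1 + y) |z|\<^sup>2\<close>. A symmetric nonnegative
  matrix whose quadratic form takes the value \<open>-t\<close> on a unit vector has squared Frobenius norm at
  least \<open>2 t\<^sup>2\<close>, so \<open>2 y\<^sup>2\<close> is at most the number of arcs of the complement. Adding up,
  \<open>x\<^sup>2 + 3 y\<^sup>2 \<le> n\<^sup>2\<close>, and \<open>(x + y)\<^sup>2 \<le> (1 + 1 / 3) (x\<^sup>2 + 3 y\<^sup>2)\<close> by Cauchy-Schwarz.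
\<close>

section \<open>Splitting polynomials and orthonormal eigenvectors\<close>

text \<open>Split off one linear factor per root. This supplies the factored characteristic
  polynomial that \<open>schur_decomposition\<close> demands.\<close>

lemma prod_mset_proots:
  fixes p :: "'a :: idom poly"
  assumes "size (proots p) = degree p" and "lead_coeff p = 1"
  shows "p = (\<Prod>x\<in>#proots p. [:-x, 1:])"
  using assms
proof (induction "degree p" arbitrary: p)
  case 0
  then show ?case by (metis degree_eq_zeroE image_mset_empty lead_coeff_pCons(2) one_pCons
        prod_mset_empty proots_const)
next
  case (Suc n)
  have p0: "p \<noteq> 0" using Suc.prems by auto
  have "proots p \<noteq> {#}" using Suc.hyps(2) Suc.prems(1) by auto
  then obtain r where "r \<in># proots p" by blast
  then have "poly p r = 0" using p0 by simp
  then obtain q where q: "p = [:-r, 1:] * q" by (metis dvdE poly_eq_0_iff_dvd)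
  have q0: "q \<noteq> 0" using q p0 by auto
  have deg: "degree p = Suc (degree q)" unfolding q by (subst degree_mult_eq) (use q0 in auto)
  have lc: "lead_coeff q = 1" using Suc.prems(2) unfolding q lead_coeff_mult by simp
  have pr: "proots p = add_mset r (proots q)"
    unfolding q by (subst proots_mult) (use q0 in auto)
  have "q = (\<Prod>x\<in>#proots q. [:-x, 1:])"
    using Suc.hyps Suc.prems(1) deg lc pr by (intro Suc.hyps(1)) auto
  then show ?case unfolding pr by (subst q) simp
qed

text \<open>Schur triangularisation gives \<open>A * P = P * B\<close> with \<open>x\<close>,
  \<open>y\<close> leading the diagonal of \<open>B\<close>. Gram-Schmidt on the first two columns
  of \<open>P\<close> yields the vectors; symmetry of \<open>A\<close> removes the off-diagonal
  coefficient. The case \<open>x = y\<close> needs no separate treatment.\<close>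

lemma orthonormal_eigenvectors:
  fixes A :: "real mat"
  assumes A: "A \<in> carrier_mat n n"
    and sym: "\<And>i j. i < n \<Longrightarrow> j < n \<Longrightarrow> A $$ (i, j) = A $$ (j, i)"
    and char: "char_poly A = (\<Prod>a\<leftarrow>x # y # es. [:-a, 1:])"
  obtains u v :: "nat \<Rightarrow> real" where
    "(\<Sum>i<n. u i * u i) = 1" "(\<Sum>i<n. v i * v i) = 1" "(\<Sum>i<n. u i * v i) = 0"
    "\<And>i. i < n \<Longrightarrow> (\<Sum>j<n. A $$ (i, j) * u j) = x * u i"
    "\<And>i. i < n \<Longrightarrow> (\<Sum>j<n. A $$ (i, j) * v j) = y * v i"
proof -
  obtain B P Q where "schur_decomposition A (x # y # es) = (B, P, Q)"
    by (metis prod_cases3)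
  from schur_decomposition[OF A char this]
  have wit: "similar_mat_wit A B P Q" and ut: "upper_triangular B"
    and diag: "diag_mat B = x # y # es" by auto
  note w = similar_mat_witD2[OF A wit]
  have car: "B \<in> carrier_mat n n" "P \<in> carrier_mat n n" "Q \<in> carrier_mat n n"
    and QP: "Q * P = 1\<^sub>m n" and APBQ: "A = P * B * Q" using w by auto
  have n: "n \<ge> 2" using diag car(1) by (auto simp: diag_mat_def dest: arg_cong[of _ _ length])
  have B00: "B $$ (0, 0) = x" and B11: "B $$ (1, 1) = y"
  proof -
    have "diag_mat B ! 0 = x" "diag_mat B ! 1 = y" by (simp_all add: diag)
    then show "B $$ (0, 0) = x" "B $$ (1, 1) = y"
      using n car(1) by (simp_all add: diag_mat_def)
  qed
  have lower: "B $$ (i, j) = 0" if "j < i" "i < n" for i j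
    using ut that car(1) by (auto simp: upper_triangular_def)
  have AP: "A * P = P * B"
  proof -
    have "A * P = P * B * (Q * P)"
      unfolding APBQ using car by (intro assoc_mult_mat) auto
    then show ?thesis using car by (simp add: QP)
  qed
  define p q where "p i = P $$ (i, 0)" and "q i = P $$ (i, 1)" for i
  define b where "b = B $$ (0, 1)"
  have entry: "(\<Sum>j<n. A $$ (i, j) * P $$ (j, k)) = (\<Sum>j<n. P $$ (i, j) * B $$ (j, k))"
    if "i < n" "k < n" for i k
  proof -
    have "(A * P) $$ (i, k) = (P * B) $$ (i, k)" by (simp add: AP)
    then show ?thesis using that car A by (simp add: scalar_prod_def lessThan_atLeast0)
  qed
  have Ap: "(\<Sum>j<n. A $$ (i, j) * p j) = x * p i" if "i < n" for i
  proof -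
    have "(\<Sum>j<n. A $$ (i, j) * p j) = (\<Sum>j<n. P $$ (i, j) * B $$ (j, 0))"
      using entry[of i 0] that n by (simp add: p_def)
    also have "\<dots> = (\<Sum>j\<in>{0}. P $$ (i, j) * B $$ (j, 0))"
      using n lower by (intro sum.mono_neutral_right) auto
    finally show ?thesis by (simp add: p_def B00)
  qed
  have Aq: "(\<Sum>j<n. A $$ (i, j) * q j) = b * p i + y * q i" if "i < n" for i
  proof -
    have "(\<Sum>j<n. A $$ (i, j) * q j) = (\<Sum>j<n. P $$ (i, j) * B $$ (j, 1))"
      using entry[of i 1] that n by (simp add: q_def)
    also have "\<dots> = (\<Sum>j\<in>{0, 1}. P $$ (i, j) * B $$ (j, 1))"
      using n lower by (intro sum.mono_neutral_right) auto
    finally show ?thesis using B11 by (simp add: p_def q_def b_def)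
  qed
  have QPe: "(\<Sum>k<n. Q $$ (i, k) * P $$ (k, j)) = (if i = j then 1 else 0)"
    if "i < n" "j < n" for i j
  proof -
    have "(Q * P) $$ (i, j) = (if i = j then 1 else 0)" using that by (simp add: QP)
    then show ?thesis using that car by (simp add: scalar_prod_def lessThan_atLeast0)
  qed
  \<comment> \<open>Vectors are seen to be nonzero by pairing them with rows of \<open>Q\<close>,
    the inverse of \<open>P\<close>: row 0 for \<open>p\<close>, row 1 for \<open>w\<close>.\<close>
  have pos: "(\<Sum>i<n. f i * f i) > 0" if "(\<Sum>i<n. g i * f i) = 1" for f g :: "nat \<Rightarrow> real"
  proof (rule ccontr)
    assume "\<not> ?thesis"
    then have "(\<Sum>i<n. f i * f i) = 0"
      by (meson linorder_not_less order_antisym sum_nonneg zero_le_square)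
    then have "\<forall>i<n. f i = 0" by (subst (asm) sum_nonneg_eq_0_iff) auto
    with that show False by simp
  qed
  define s where "s = sqrt (\<Sum>i<n. p i * p i)"
  have s: "s > 0" "s * s = (\<Sum>i<n. p i * p i)"
    using pos[of "\<lambda>k. Q $$ (0, k)" p] QPe[of 0 0] n by (auto simp: s_def p_def)
  define u where "u i = p i / s" for i
  have uu: "(\<Sum>i<n. u i * u i) = 1"
    using s(1) by (simp add: u_def flip: s(2) sum_divide_distrib)
  have Au: "(\<Sum>j<n. A $$ (i, j) * u j) = x * u i" if "i < n" for i
    using Ap[OF that] by (simp add: u_def flip: sum_divide_distrib)
  define c where "c = (\<Sum>i<n. u i * q i)"
  define w where "w i = q i - c * u i" for i
  have uw: "(\<Sum>i<n. u i * w i) = 0"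
  proof -
    have "(\<Sum>i<n. u i * w i) = (\<Sum>i<n. u i * q i) - c * (\<Sum>i<n. u i * u i)"
      by (simp add: w_def algebra_simps sum_subtractf sum_distrib_left)
    then show ?thesis by (simp add: uu c_def)
  qed
  \<comment> \<open>Row 1 of \<open>Q\<close> annihilates \<open>p\<close>, hence \<open>u\<close>,
    and takes the value 1 on \<open>q\<close>.\<close>
  have Qw: "(\<Sum>k<n. Q $$ (1, k) * w k) = 1"
  proof -
    have "(\<Sum>k<n. Q $$ (1, k) * w k)
        = (\<Sum>k<n. Q $$ (1, k) * q k) - c / s * (\<Sum>k<n. Q $$ (1, k) * p k)"
      by (simp add: w_def u_def algebra_simps sum_subtractf sum_distrib_left)
    then show ?thesis using QPe[of 1 1] QPe[of 1 0] n by (simp add: p_def q_def)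
  qed
  \<comment> \<open>The coefficient of \<open>u\<close> in \<open>A w\<close>, found by substituting
    \<open>p = s u\<close> and \<open>q = w + c u\<close>.\<close>
  define d where "d = b * s + y * c - c * x"
  have Aw: "(\<Sum>j<n. A $$ (i, j) * w j) = y * w i + d * u i" if "i < n" for i
  proof -
    have "(\<Sum>j<n. A $$ (i, j) * w j)
        = (\<Sum>j<n. A $$ (i, j) * q j) - c * (\<Sum>j<n. A $$ (i, j) * u j)"
      by (simp add: w_def algebra_simps sum_subtractf sum_distrib_left)
    also have "\<dots> = b * p i + y * q i - c * (x * u i)"
      using Aq Au that by simp
    also have "b * p i = b * s * u i" using s by (simp add: u_def)
    finally show ?thesis by (simp add: w_def d_def algebra_simps)
  qed
  \<comment> \<open>Pairing with \<open>u\<close> gives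
    \<open>d = <u, A w> = <A u, w> = x <u, w> = 0\<close>.\<close>
  have "d = 0"
  proof -
    have "(\<Sum>i<n. u i * (\<Sum>j<n. A $$ (i, j) * w j)) = (\<Sum>i<n. y * (u i * w i) + d * (u i * u i))"
      by (intro sum.cong) (simp_all add: Aw distrib_left mult.left_commute)
    then have "d = (\<Sum>i<n. u i * (\<Sum>j<n. A $$ (i, j) * w j))"
      using uu uw by (simp add: sum.distrib flip: sum_distrib_left)
    also have "\<dots> = (\<Sum>j<n. \<Sum>i<n. u i * (A $$ (i, j) * w j))"
      unfolding sum_distrib_left by (rule sum.swap)
    also have "\<dots> = (\<Sum>j<n. w j * (\<Sum>i<n. A $$ (j, i) * u i))"
      unfolding sum_distrib_left by (intro sum.cong) (auto simp: sym)
    also have "\<dots> = (\<Sum>j<n. x * (u j * w j))"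
      by (intro sum.cong) (auto simp: Au)
    also have "\<dots> = 0" using uw by (simp flip: sum_distrib_left)
    finally show ?thesis .
  qed
  define t where "t = sqrt (\<Sum>i<n. w i * w i)"
  have t: "t > 0" "t * t = (\<Sum>i<n. w i * w i)"
    using pos[OF Qw] by (auto simp: t_def)
  show thesis
  proof (rule that[of u "\<lambda>i. w i / t"])
    show "(\<Sum>i<n. w i / t * (w i / t)) = 1"
      using t(1) by (simp flip: t(2) sum_divide_distrib)
    show "(\<Sum>i<n. u i * (w i / t)) = 0" using uw by (simp flip: sum_divide_distrib)
    show "(\<Sum>j<n. A $$ (i, j) * (w j / t)) = y * (w i / t)" if "i < n" for i
      using Aw[OF that] \<open>d = 0\<close> by (simp flip: sum_divide_distrib)
  qed (use uu Au in auto)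
qed

section \<open>Frobenius norm estimates\<close>

text \<open>Bessel's inequality for each row: row \<open>i\<close> has coefficients
  \<open>x * u i\<close> and \<open>y * v i\<close> against the orthonormal pair. Then sum over the
  rows.\<close>

lemma sum_squared_eigenvalues_le:
  fixes a :: "'b \<Rightarrow> 'b \<Rightarrow> real"
  assumes uu: "(\<Sum>i\<in>I. u i * u i) = 1" and vv: "(\<Sum>i\<in>I. v i * v i) = 1"
    and uv: "(\<Sum>i\<in>I. u i * v i) = 0"
    and Au: "\<And>i. i \<in> I \<Longrightarrow> (\<Sum>j\<in>I. a i j * u j) = x * u i"
    and Av: "\<And>i. i \<in> I \<Longrightarrow> (\<Sum>j\<in>I. a i j * v j) = y * v i"
  shows "x\<^sup>2 + y\<^sup>2 \<le> (\<Sum>i\<in>I. \<Sum>j\<in>I. (a i j)\<^sup>2)"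
proof -
  have "0 \<le> (\<Sum>j\<in>I. (a i j - (x * u i * u j + y * v i * v j))\<^sup>2)" for i
    by (intro sum_nonneg) auto
  also have "(\<Sum>j\<in>I. (a i j - (x * u i * u j + y * v i * v j))\<^sup>2)
      = (\<Sum>j\<in>I. (a i j)\<^sup>2) - x\<^sup>2 * (u i * u i) - y\<^sup>2 * (v i * v i)" if "i \<in> I" for i
  proof -
    have "(\<Sum>j\<in>I. (a i j - (x * u i * u j + y * v i * v j))\<^sup>2)
        = (\<Sum>j\<in>I. (a i j)\<^sup>2) - 2 * x * u i * (\<Sum>j\<in>I. a i j * u j)
          - 2 * y * v i * (\<Sum>j\<in>I. a i j * v j) + x\<^sup>2 * (u i)\<^sup>2 * (\<Sum>j\<in>I. u j * u j)
          + y\<^sup>2 * (v i)\<^sup>2 * (\<Sum>j\<in>I. v j * v j) + 2 * x * y * u i * v i * (\<Sum>j\<in>I. u j * v j)"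
      unfolding sum_distrib_left sum_subtractf[symmetric] sum.distrib[symmetric]
      by (intro sum.cong) (auto simp: power2_eq_square algebra_simps)
    then show ?thesis
      unfolding uu vv uv Au[OF that] Av[OF that] by (simp add: power2_eq_square)
  qed
  finally have "x\<^sup>2 * (u i * u i) + y\<^sup>2 * (v i * v i) \<le> (\<Sum>j\<in>I. (a i j)\<^sup>2)" if "i \<in> I" for i
    using that by fastforce
  then have "(\<Sum>i\<in>I. x\<^sup>2 * (u i * u i) + y\<^sup>2 * (v i * v i)) \<le> (\<Sum>i\<in>I. \<Sum>j\<in>I. (a i j)\<^sup>2)"
    by (rule sum_mono)
  then show ?thesis using uu vv by (simp add: sum.distrib flip: sum_distrib_left)
qed

text \<open>Cauchy-Schwarz for \<open>b\<close> and the matrix \<open>m\<close>, which vanishes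
  where \<open>z i * z j\<close> is nonnegative and equals \<open>- 2 * (z i * z j)\<close>
  elsewhere. It is carried out as nonnegativity of the squared norm of
  \<open>b - k m\<close>.\<close>

lemma nonneg_matrix_form_bound:
  fixes b :: "'b \<Rightarrow> 'b \<Rightarrow> real"
  assumes b: "\<And>i j. i \<in> I \<Longrightarrow> j \<in> I \<Longrightarrow> b i j \<ge> 0"
    and s: "s > 0" "(\<Sum>i\<in>I. z i * z i) = s"
    and t: "t \<ge> 0" "(\<Sum>i\<in>I. \<Sum>j\<in>I. b i j * (z i * z j)) \<le> - t * s"
  shows "2 * t\<^sup>2 \<le> (\<Sum>i\<in>I. \<Sum>j\<in>I. (b i j)\<^sup>2)"
proof -
  define m where "m i j = \<bar>z i * z j\<bar> - z i * z j" for i j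
  \<comment> \<open>The optimal multiplier \<open>(2 * t * s) / (2 * s^2)\<close> for the bounds
    \<open>bm\<close> and \<open>mm\<close>.\<close>
  define k where "k = t / s"
  have mm: "(\<Sum>i\<in>I. \<Sum>j\<in>I. (m i j)\<^sup>2) \<le> 2 * s\<^sup>2"
  proof -
    have "(m i j)\<^sup>2 = 2 * ((z i * z i) * (z j * z j)) - 2 * ((z i * \<bar>z i\<bar>) * (z j * \<bar>z j\<bar>))" for i j
      by (simp add: m_def power2_eq_square abs_mult algebra_simps)
    then have "(\<Sum>i\<in>I. \<Sum>j\<in>I. (m i j)\<^sup>2) = 2 * s\<^sup>2 - 2 * (\<Sum>i\<in>I. z i * \<bar>z i\<bar>)\<^sup>2"
      unfolding power2_eq_square[of s] power2_eq_square[of "sum _ _"] s(2)[symmetric] sum_product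
      by (simp add: sum_subtractf sum_distrib_left)
    then show ?thesis by simp
  qed
  have bm: "(\<Sum>i\<in>I. \<Sum>j\<in>I. b i j * m i j) \<ge> 2 * t * s"
  proof -
    have "(\<Sum>i\<in>I. \<Sum>j\<in>I. b i j * m i j) \<ge> (\<Sum>i\<in>I. \<Sum>j\<in>I. b i j * (- 2 * (z i * z j)))"
      using b by (intro sum_mono mult_left_mono) (auto simp: m_def)
    moreover have "(\<Sum>i\<in>I. \<Sum>j\<in>I. b i j * (- 2 * (z i * z j)))
        = - 2 * (\<Sum>i\<in>I. \<Sum>j\<in>I. b i j * (z i * z j))"
      unfolding sum_distrib_left by (intro sum.cong) auto
    ultimately show ?thesis using t(2) by linarith
  qed
  have "0 \<le> (\<Sum>i\<in>I. \<Sum>j\<in>I. (b i j - k * m i j)\<^sup>2)"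
    by (intro sum_nonneg) auto
  also have "\<dots> = (\<Sum>i\<in>I. \<Sum>j\<in>I. (b i j)\<^sup>2) - 2 * k * (\<Sum>i\<in>I. \<Sum>j\<in>I. b i j * m i j)
      + k\<^sup>2 * (\<Sum>i\<in>I. \<Sum>j\<in>I. (m i j)\<^sup>2)"
    unfolding sum_distrib_left sum_subtractf[symmetric] sum.distrib[symmetric]
    by (intro sum.cong) (auto simp: power2_eq_square algebra_simps)
  also have "\<dots> \<le> (\<Sum>i\<in>I. \<Sum>j\<in>I. (b i j)\<^sup>2) - 2 * k * (2 * t * s) + k\<^sup>2 * (2 * s\<^sup>2)"
    using s t mm bm by (intro add_mono diff_mono mult_left_mono) (auto simp: k_def)
  also have "\<dots> = (\<Sum>i\<in>I. \<Sum>j\<in>I. (b i j)\<^sup>2) - 2 * t\<^sup>2"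
    using s(1) by (simp add: k_def power2_eq_square field_simps)
  finally show ?thesis by simp
qed

section \<open>The bound for 0-1 matrices with zero diagonal\<close>

lemma sum_two_eigenvalues_le:
  fixes a :: "'b \<Rightarrow> 'b \<Rightarrow> real"
  assumes fin: "finite I"
    and a01: "\<And>i j. i \<in> I \<Longrightarrow> j \<in> I \<Longrightarrow> a i j \<in> {0, 1}"
    and a0: "\<And>i. i \<in> I \<Longrightarrow> a i i = 0"
    and uu: "(\<Sum>i\<in>I. u i * u i) = 1" and vv: "(\<Sum>i\<in>I. v i * v i) = 1"
    and uv: "(\<Sum>i\<in>I. u i * v i) = 0"
    and Au: "\<And>i. i \<in> I \<Longrightarrow> (\<Sum>j\<in>I. a i j * u j) = x * u i"
    and Av: "\<And>i. i \<in> I \<Longrightarrow> (\<Sum>j\<in>I. a i j * v j) = y * v i"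
    and yx: "y \<le> x"
  shows "x + y \<le> 2 / sqrt 3 * real (card I)"
proof -
  define n where "n = real (card I)"
  define e where "e = (\<Sum>i\<in>I. \<Sum>j\<in>I. (a i j)\<^sup>2)"
  have xy: "x\<^sup>2 + y\<^sup>2 \<le> e"
    unfolding e_def using uu vv uv Au Av by (rule sum_squared_eigenvalues_le)
  define b where "b i j = 1 - of_bool (i = j) - a i j" for i j
  have b0: "b i j \<ge> 0" if "i \<in> I" "j \<in> I" for i j
    using a01[OF that] a0[OF that(1)] by (auto simp: b_def)
  define f where "f = (\<Sum>i\<in>I. \<Sum>j\<in>I. (b i j)\<^sup>2)"
  \<comment> \<open>Off the diagonal exactly one of \<open>a i j\<close>, \<open>b i j\<close> is 1;
    on it both are 0.\<close>
  have ef: "e + f \<le> n\<^sup>2"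
  proof -
    have "e + f = (\<Sum>i\<in>I. \<Sum>j\<in>I. (a i j)\<^sup>2 + (b i j)\<^sup>2)"
      by (simp add: e_def f_def sum.distrib)
    also have "\<dots> \<le> (\<Sum>i\<in>I. \<Sum>j\<in>I. 1)"
    proof (intro sum_mono)
      fix i j assume "i \<in> I" "j \<in> I"
      then show "(a i j)\<^sup>2 + (b i j)\<^sup>2 \<le> 1"
        using a01[of i j] a0[of i] by (auto simp: b_def)
    qed
    finally show ?thesis by (simp add: n_def power2_eq_square)
  qed
  have f0: "f \<ge> 0" unfolding f_def by (intro sum_nonneg) auto
  have "(x + y)\<^sup>2 \<le> (2 / sqrt 3 * n)\<^sup>2" if "y \<ge> 0"
  proof -
    \<comment> \<open>Orthogonality to the all-ones vector is one linear condition on two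
      coefficients, so it has a nonzero solution.\<close>
    obtain \<alpha> \<beta> where \<alpha>\<beta>: "\<alpha> * (\<Sum>i\<in>I. u i) + \<beta> * (\<Sum>i\<in>I. v i) = 0" "\<alpha> \<noteq> 0 \<or> \<beta> \<noteq> 0"
    proof (cases "(\<Sum>i\<in>I. v i) = 0")
      case True
      then show ?thesis using that[of 0 1] by simp
    next
      case False
      then show ?thesis using that[of "\<Sum>i\<in>I. v i" "- (\<Sum>i\<in>I. u i)"] by simp
    qed
    define z where "z i = \<alpha> * u i + \<beta> * v i" for i
    define s where "s = \<alpha>\<^sup>2 + \<beta>\<^sup>2"
    have s: "s > 0" using \<alpha>\<beta>(2) by (auto simp: s_def sum_power2_gt_zero_iff)
    have z1: "(\<Sum>i\<in>I. z i) = 0"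
      using \<alpha>\<beta>(1) by (simp add: z_def sum.distrib sum_distrib_left)
    have zz: "(\<Sum>i\<in>I. z i * z i) = s"
    proof -
      have "(\<Sum>i\<in>I. z i * z i) = \<alpha>\<^sup>2 * (\<Sum>i\<in>I. u i * u i) + \<beta>\<^sup>2 * (\<Sum>i\<in>I. v i * v i)
          + 2 * \<alpha> * \<beta> * (\<Sum>i\<in>I. u i * v i)"
        unfolding sum_distrib_left sum.distrib[symmetric]
        by (intro sum.cong) (auto simp: z_def power2_eq_square algebra_simps)
      then show ?thesis by (simp add: uu vv uv s_def)
    qed
    have Az: "(\<Sum>j\<in>I. a i j * z j) = \<alpha> * x * u i + \<beta> * y * v i" if "i \<in> I" for i
    proof -
      have "(\<Sum>j\<in>I. a i j * z j) = \<alpha> * (\<Sum>j\<in>I. a i j * u j) + \<beta> * (\<Sum>j\<in>I. a i j * v j)"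
        by (simp add: z_def algebra_simps sum.distrib sum_distrib_left)
      then show ?thesis using Au Av that by simp
    qed
    \<comment> \<open>The mixed terms cancel by orthogonality, leaving
      \<open>\<alpha>^2 * x + \<beta>^2 * y\<close>, and \<open>x\<close> is at least
      \<open>y\<close>.\<close>
    have zAz: "(\<Sum>i\<in>I. z i * (\<Sum>j\<in>I. a i j * z j)) \<ge> y * s"
    proof -
      have "(\<Sum>i\<in>I. z i * (\<Sum>j\<in>I. a i j * z j))
          = (\<Sum>i\<in>I. (\<alpha> * u i + \<beta> * v i) * (\<alpha> * x * u i + \<beta> * y * v i))"
        by (intro sum.cong refl arg_cong2[where f = "(*)"] z_def Az)
      also have "\<dots> = \<alpha>\<^sup>2 * x * (\<Sum>i\<in>I. u i * u i) + \<beta>\<^sup>2 * y * (\<Sum>i\<in>I. v i * v i)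
          + \<alpha> * \<beta> * (x + y) * (\<Sum>i\<in>I. u i * v i)"
        unfolding sum_distrib_left[of "_ * _"] sum.distrib[symmetric]
        by (intro sum.cong) (auto simp: power2_eq_square algebra_simps)
      also have "\<dots> = \<alpha>\<^sup>2 * x + \<beta>\<^sup>2 * y" by (simp add: uu vv uv)
      also have "\<dots> \<ge> \<alpha>\<^sup>2 * y + \<beta>\<^sup>2 * y" using yx by (intro add_mono mult_left_mono) auto
      finally show ?thesis by (simp add: s_def algebra_simps)
    qed
    \<comment> \<open>The all-ones part of \<open>b\<close> contributes a multiple of the sum of
      \<open>z\<close>, which is zero by \<open>z1\<close>.\<close>
    have "(\<Sum>i\<in>I. \<Sum>j\<in>I. b i j * (z i * z j)) = (\<Sum>i\<in>I. z i * (\<Sum>j\<in>I. z j) - z i * z i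
        - z i * (\<Sum>j\<in>I. a i j * z j))"
    proof (intro sum.cong refl)
      fix i assume i: "i \<in> I"
      have "(\<Sum>j\<in>I. b i j * (z i * z j)) = (\<Sum>j\<in>I. z i * z j - (if i = j then z i * z j else 0)
          - z i * (a i j * z j))"
        by (intro sum.cong) (auto simp: b_def algebra_simps)
      then show "(\<Sum>j\<in>I. b i j * (z i * z j)) = z i * (\<Sum>j\<in>I. z j) - z i * z i
          - z i * (\<Sum>j\<in>I. a i j * z j)"
        using fin i by (simp add: sum_subtractf sum_distrib_left)
    qed
    also have "\<dots> = - s - (\<Sum>i\<in>I. z i * (\<Sum>j\<in>I. a i j * z j))"
      using z1 zz by (simp add: sum_subtractf sum_negf)
    also have "\<dots> \<le> - (1 + y) * s" using zAz by (simp add: algebra_simps)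
    finally have "2 * (1 + y)\<^sup>2 \<le> f"
      unfolding f_def using b0 s zz that by (intro nonneg_matrix_form_bound[where z = z]) auto
    moreover have "y\<^sup>2 \<le> (1 + y)\<^sup>2" using that by (intro power_mono) auto
    ultimately have "x\<^sup>2 + 3 * y\<^sup>2 \<le> n\<^sup>2" using xy ef by linarith
    \<comment> \<open>This square is the Cauchy-Schwarz defect
      \<open>4 * (x^2 + 3 * y^2) - 3 * (x + y)^2\<close>.\<close>
    moreover have "0 \<le> (x - 3 * y)\<^sup>2" by simp
    ultimately have "3 * (x + y)\<^sup>2 \<le> 4 * n\<^sup>2" by (simp add: power2_eq_square algebra_simps)
    then show ?thesis by (simp add: power_mult_distrib power_divide)
  qed
  \<comment> \<open>A negative \<open>y\<close> only lowers the sum, so \<open>x \<le> n\<close>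
    suffices, the constant \<open>2 / sqrt 3\<close> being at least 1.\<close>
  moreover have "x + y \<le> 2 / sqrt 3 * n" if "y < 0"
  proof -
    have "x\<^sup>2 \<le> n\<^sup>2" using xy ef f0 zero_le_power2[of y] by linarith
    then have "x \<le> n" by (rule power2_le_imp_le) (simp add: n_def)
    moreover have "sqrt 3 \<le> 2" by (rule real_le_lsqrt) auto
    then have "1 * n \<le> 2 / sqrt 3 * n" by (intro mult_right_mono) (auto simp: n_def)
    ultimately show ?thesis using that by linarith
  qed
  ultimately show ?thesis
    unfolding n_def by (metis linorder_not_less of_nat_0_le_iff power2_le_imp_le
        divide_nonneg_nonneg mult_nonneg_nonneg real_sqrt_ge_zero zero_le_numeral)
qed

section \<open>Application to adjacency matrices\<close>

theorem proposition5:
  fixes G :: "'a pair_pre_digraph"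
  assumes "pair_graph G"
    and "graph_order G \<ge> 2"
  shows "\<mu> G 1 + \<mu> G 2 \<le> 2 / sqrt 3 * real (graph_order G)"
proof -
  interpret pair_graph G by fact
  define vs where "vs = vertex_list G"
  have vs: "distinct vs \<and> set vs = pverts G"
    unfolding vs_def vertex_list_def
    by (rule someI_ex) (metis pair_finite_verts finite_distinct_list)
  then have n: "length vs = graph_order G"
    by (metis distinct_card graph_order_def)
  define A where "A = adjacency_mat G vs"
  have A: "A \<in> carrier_mat (length vs) (length vs)" by (simp add: A_def)
  have sym: "A $$ (i, j) = A $$ (j, i)" if "i < length vs" "j < length vs" for i j
    using that pair_sym_arcs by (auto simp: A_def adjacency_mat_def symmetric_def dest: symD)
  define L where "L = adjacency_eigenvalues G"
  have L: "length L = graph_order G" "mset L = proots (char_poly A)" "sorted (rev L)"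
    using length_adjacency_eigenvalues[OF assms(1)]
    by (simp_all add: L_def adjacency_eigenvalues_def A_def vs_def)
  then obtain x y es where xy: "L = x # y # es"
    using assms(2) by (cases L; cases "tl L") auto
  have deg: "degree (char_poly A) = length vs" "lead_coeff (char_poly A) = 1"
    using degree_monic_char_poly[OF A] by auto
  \<comment> \<open>By \<open>length_adjacency_eigenvalues\<close> there are as many real roots,
    with multiplicity, as the degree.\<close>
  have "char_poly A = (\<Prod>a\<in>#mset L. [:-a, 1:])"
    unfolding L(2) using deg L n by (intro prod_mset_proots) (auto simp flip: size_mset)
  \<comment> \<open>The factors may be listed in any order; the decreasing one puts the two largest
    eigenvalues first.\<close>
  then have char: "char_poly A = (\<Prod>a\<leftarrow>x # y # es. [:-a, 1:])"
    by (metis xy mset_map prod_mset_prod_list)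
  obtain u v where uv:
    "(\<Sum>i<length vs. u i * u i) = 1" "(\<Sum>i<length vs. v i * v i) = 1"
    "(\<Sum>i<length vs. u i * v i) = 0"
    "\<And>i. i < length vs \<Longrightarrow> (\<Sum>j<length vs. A $$ (i, j) * u j) = x * u i"
    "\<And>i. i < length vs \<Longrightarrow> (\<Sum>j<length vs. A $$ (i, j) * v j) = y * v i"
    using orthonormal_eigenvectors[OF A sym char] by blast
  have "y \<le> x" using L(3) by (simp add: xy sorted_append)
  then have "x + y \<le> 2 / sqrt 3 * real (card {..<length vs})"
    using uv
    by (intro sum_two_eigenvalues_le[where a = "\<lambda>i j. A $$ (i, j)" and u = u and v = v])
      (auto simp: A_def adjacency_mat_def dest: pair_no_loops)
  then show ?thesis
    using n by (simp add: \<mu>_def flip: L_def) (simp add: xy)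
qed

end
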